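(* Let $k\ge 2$ be an integer, $\pi\in S_k$, $\epsilon>0$, and let $\delta_0\ge 1$ and $\Delta_0$ be positive constants. There is a constant $c=c(k,\pi,\epsilon,\delta_0,\Delta_0)$ such that the following holds. Let $n, L$ be positive integers and let $\Lambda$ be a $k$-uniform hypergraph on vertex set $\{1,\dots,n\}$ which contains a collection of $L$-vertex cliques (sets of $L$ vertices all of whose $k$-subsets are edges of $\Lambda$) such that each of the $n$ vertices belongs to at least $\delta_0$ and at most $\Delta_0$ cliques of the collection. Then the number of $\sigma\in S_n$ that $\Lambda$-avoid $\pi$ is at most \[\left(\frac{c\, n\log^{2+\epsilon}n}{L}\right)^n.\]
   Context: For a $k$-uniform hypergraph $\Lambda$ on vertex set $\{1,\dots,n\}$, a permutation $\sigma\in S_n$ $\Lambda$-contains $\pi\in S_k$ if there exist integers $1\le x_1<\dots<x_k\le n$ with $\{x_1,\dots,x_k\}\in E(\Lambda)$ such that for all $i,j$, $\pi(i)<\pi(j)\iff\sigma(x_i)<\sigma(x_j)$; otherwise $\sigma$ $\Lambda$-avoids $\pi$.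
   Formalization: The theorem is stated for n at least 2 instead of all positive n: at n = 1 the bound is 0 because log 1 = 0, while the identity permutation avoids the pattern (e.g. L = 1, the single clique {1}, no edges), so the claim fails there. *)

theory Defs
  imports "HOL-Analysis.Analysis"
begin

definition k_uniform_hypergraph :: "nat \<Rightarrow> nat \<Rightarrow> nat set set \<Rightarrow> bool" where
  "k_uniform_hypergraph k n E \<longleftrightarrow> (\<forall>e\<in>E. e \<subseteq> {1..n} \<and> card e = k)"

definition hcontains :: "nat set set \<Rightarrow> (nat \<Rightarrow> nat) \<Rightarrow> nat \<Rightarrow> (nat \<Rightarrow> nat) \<Rightarrow> bool" where
  "hcontains E \<sigma> k \<pi> \<longleftrightarrow>
     (\<exists>x :: nat \<Rightarrow> nat. strict_mono_on {1..k} x \<and> x ` {1..k} \<in> E \<and>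
        (\<forall>i\<in>{1..k}. \<forall>j\<in>{1..k}. \<pi> i < \<pi> j \<longleftrightarrow> \<sigma> (x i) < \<sigma> (x j)))"

definition havoids :: "nat set set \<Rightarrow> (nat \<Rightarrow> nat) \<Rightarrow> nat \<Rightarrow> (nat \<Rightarrow> nat) \<Rightarrow> bool" where
  "havoids E \<sigma> k \<pi> \<longleftrightarrow> \<not> hcontains E \<sigma> k \<pi>"

definition is_clique :: "nat \<Rightarrow> nat \<Rightarrow> nat set set \<Rightarrow> nat \<Rightarrow> nat set \<Rightarrow> bool" where
  "is_clique k n E L Q \<longleftrightarrow> Q \<subseteq> {1..n} \<and> card Q = L \<and>
     (\<forall>S. S \<subseteq> Q \<and> card S = k \<longrightarrow> S \<in> E)"

end

theory Submission
  imports Defs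
begin

text \<open>
  Assign to every vertex one clique containing it. Since every clique has $L$ vertices and the
  degrees are at most $\Delta_0$, there are at most $\Delta_0 n / L$ cliques. A permutation is
  determined by the clique assigned to the preimage of each value, which leaves
  $(\Delta_0 n / L)^n$ choices, and by its restrictions to the resulting disjoint classes. Each
  restriction avoids the pattern in the ordinary sense, so the Marcus--Tardos theorem allows at most
  $K^q$ of them on a class of size $q$. The resulting bound $(\Delta_0 K n / L)^n$ contains no
  logarithm.
\<close>

section \<open>The Marcus--Tardos bound\<close>

text \<open>Point sets play the role of 0-1 matrices, and this is containment of the permutation
  matrix of \<open>\<pi>\<close>: \<open>x\<close> lists the chosen columns and \<open>y\<close> the
  chosen rows in increasing order, so the point over column \<open>x i\<close> has height
  \<open>y (\<pi> i)\<close>.\<close>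

definition mcontains :: "nat \<Rightarrow> (nat \<Rightarrow> nat) \<Rightarrow> (nat \<times> nat) set \<Rightarrow> bool" where
  "mcontains k \<pi> M \<longleftrightarrow>
     (\<exists>x y. strict_mono_on {1..k} x \<and> strict_mono_on {1..k} y \<and> (\<forall>i\<in>{1..k}. (x i, y (\<pi> i)) \<in> M))"

text \<open>Points are found column by column, with heights \<open>b\<close> indexed by position.
  Reindexing them by \<open>inv \<pi>\<close> lists the heights in increasing order, the form that
  \<open>mcontains\<close> expects.\<close>

lemma mcontainsI:
  assumes \<pi>: "\<pi> permutes {1..k}"
    and a: "strict_mono_on {1..k} a"
    and b: "\<And>i j. i \<in> {1..k} \<Longrightarrow> j \<in> {1..k} \<Longrightarrow> \<pi> i < \<pi> j \<Longrightarrow> b i < b j"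
    and M: "\<And>i. i \<in> {1..k} \<Longrightarrow> (a i, b i) \<in> M"
  shows "mcontains k \<pi> M"
  unfolding mcontains_def
proof (intro exI conjI ballI)
  show "strict_mono_on {1..k} a" by (rule a)
  show "strict_mono_on {1..k} (b \<circ> inv \<pi>)"
  proof (rule strict_mono_onI)
    fix r s assume "r \<in> {1..k}" "s \<in> {1..k}" "r < s"
    moreover from this have "inv \<pi> r \<in> {1..k}" "inv \<pi> s \<in> {1..k}"
      by (simp_all only: permutes_in_image[OF permutes_inv[OF \<pi>]])
    ultimately show "(b \<circ> inv \<pi>) r < (b \<circ> inv \<pi>) s"
      by (auto simp: permutes_inverses[OF \<pi>] intro: b)
  qed
  show "(a i, (b \<circ> inv \<pi>) (\<pi> i)) \<in> M" if "i \<in> {1..k}" for i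
    using M[OF that] by (simp add: permutes_inverses[OF \<pi>])
qed

text \<open>Transposing a permutation matrix inverts the permutation. This reduces bounds for rows
  to bounds for columns.\<close>

lemma mcontains_converse:
  assumes \<pi>: "\<pi> permutes {1..k}" and "mcontains k (inv \<pi>) (M\<inverse>)"
  shows "mcontains k \<pi> M"
proof -
  obtain x y where xy: "strict_mono_on {1..k} x" "strict_mono_on {1..k} y"
    "\<forall>i\<in>{1..k}. (x i, y (inv \<pi> i)) \<in> M\<inverse>"
    using assms(2) unfolding mcontains_def by blast
  have "(y i, x (\<pi> i)) \<in> M" if "i \<in> {1..k}" for i
  proof -
    have "\<pi> i \<in> {1..k}" using that by (simp only: permutes_in_image[OF \<pi>])
    then show ?thesis using xy(3) by (fastforce simp: permutes_inverses[OF \<pi>])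
  qed
  then show ?thesis using xy unfolding mcontains_def by blast
qed

section \<open>Contraction to square blocks\<close>

definition block :: "nat \<Rightarrow> nat \<times> nat \<Rightarrow> nat \<times> nat" where
  "block s = (\<lambda>(a, b). (a div s, b div s))"

lemma div_less_imp_less: "a div s < b div s \<Longrightarrow> a < b" for a b s :: nat
  by (meson div_le_mono linorder_not_le)

text \<open>Choose one point in each block used. A permutation pattern meets each of its block
  columns and block rows only once, so every comparison is between distinct quotients, and it passes
  to the coordinates.\<close>

lemma mcontains_of_blocks:
  assumes \<pi>: "\<pi> permutes {1..k}" and "mcontains k \<pi> (block s ` M)"
  shows "mcontains k \<pi> M"
proof -
  obtain x y where xy: "strict_mono_on {1..k} x" "strict_mono_on {1..k} y"
    "\<forall>i\<in>{1..k}. (x i, y (\<pi> i)) \<in> block s ` M"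
    using assms(2) unfolding mcontains_def by blast
  have "\<forall>i\<in>{1..k}. \<exists>p\<in>M. block s p = (x i, y (\<pi> i))"
    using xy(3) by (metis image_iff)
  then obtain p where p: "\<And>i. i \<in> {1..k} \<Longrightarrow> p i \<in> M"
    "\<And>i. i \<in> {1..k} \<Longrightarrow> block s (p i) = (x i, y (\<pi> i))" by metis
  have d: "fst (p i) div s = x i" "snd (p i) div s = y (\<pi> i)" if "i \<in> {1..k}" for i
    using p(2)[OF that] by (auto simp: block_def split: prod.splits)
  show ?thesis
  proof (rule mcontainsI[OF \<pi>])
    show "strict_mono_on {1..k} (\<lambda>i. fst (p i))"
    proof (rule strict_mono_onI)
      fix i j assume ij: "i \<in> {1..k}" "j \<in> {1..k}" "i < j"
      show "fst (p i) < fst (p j)"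
        by (rule div_less_imp_less[of _ s])
          (use strict_mono_onD[OF xy(1) ij] ij d in simp)
    qed
    show "snd (p i) < snd (p j)" if ij: "i \<in> {1..k}" "j \<in> {1..k}" "\<pi> i < \<pi> j" for i j
    proof (rule div_less_imp_less[of _ s])
      have "\<pi> i \<in> {1..k}" "\<pi> j \<in> {1..k}" using ij by (simp_all only: permutes_in_image[OF \<pi>])
      then show "snd (p i) div s < snd (p j) div s"
        using strict_mono_onD[OF xy(2)] ij d by simp
    qed
    show "(fst (p i), snd (p i)) \<in> M" if "i \<in> {1..k}" for i using p(1)[OF that] by simp
  qed
qed

section \<open>Blocks with many occupied columns\<close>

lemma obtain_strict_mono_on_into:
  fixes S :: "nat set"
  assumes "finite S" "k \<le> card S"
  obtains x where "strict_mono_on {1..k} x" "x ` {1..k} \<subseteq> S"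
proof
  \<comment> \<open>\<open>enumerate\<close> starts at 0, pattern positions start at 1.\<close>
  show "strict_mono_on {1..k} (\<lambda>i. enumerate S (i - 1))"
    by (rule strict_mono_onI) (use assms in \<open>auto intro!: finite_enumerate_mono\<close>)
  show "(\<lambda>i. enumerate S (i - 1)) ` {1..k} \<subseteq> S"
    using assms by (auto intro!: finite_enumerate_in_set)
qed

text \<open>Rows are treated as columns of the converse relation.\<close>

definition block_cols :: "nat \<Rightarrow> (nat \<times> nat) set \<Rightarrow> nat \<times> nat \<Rightarrow> nat set" where
  "block_cols s M p = fst ` {q \<in> M. block s q = p}"

lemma block_cols_subset:
  assumes "s > 0"
  shows "block_cols s M (i, j) \<subseteq> {i * s..<i * s + s}"
proof
  fix a assume "a \<in> block_cols s M (i, j)"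
  then have "a div s = i" by (auto simp: block_cols_def block_def)
  then show "a \<in> {i * s..<i * s + s}"
    using assms by (auto simp: dividend_less_times_div mult.commute add.commute)
qed

text \<open>Pigeonhole: each wide block in block column \<open>i\<close> selects \<open>k\<close> of
  its occupied columns, and there are at most \<open>2 ^ s\<close> column sets. With more than
  \<open>k * 2 ^ s\<close> wide blocks, some \<open>k\<close> of them would share a
  selection.\<close>

lemma card_wide_blocks_le:
  assumes \<pi>: "\<pi> permutes {1..k}" and M: "\<not> mcontains k \<pi> M" and s: "s > 0" and fin: "finite W"
    and W: "\<And>j. j \<in> W \<Longrightarrow> k \<le> card (block_cols s M (i, j))"
  shows "card W \<le> k * 2 ^ s"
proof (rule ccontr)
  assume "\<not> ?thesis"
  let ?I = "{i * s..<i * s + s}"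
  have "\<forall>j\<in>W. \<exists>S. S \<subseteq> block_cols s M (i, j) \<and> card S = k"
    using W by (metis obtain_subset_with_card_n)
  then obtain S where S: "\<And>j. j \<in> W \<Longrightarrow> S j \<subseteq> block_cols s M (i, j)"
    "\<And>j. j \<in> W \<Longrightarrow> card (S j) = k" by metis
  have "W \<subseteq> (\<Union>T\<in>Pow ?I. {j \<in> W. S j = T})"
  proof
    fix j assume "j \<in> W"
    moreover from this have "S j \<subseteq> ?I" by (rule subset_trans[OF S(1) block_cols_subset[OF s]])
    ultimately show "j \<in> (\<Union>T\<in>Pow ?I. {j \<in> W. S j = T})" by simp
  qed
  then have "card W \<le> card (\<Union>T\<in>Pow ?I. {j \<in> W. S j = T})"
    by (rule card_mono[rotated]) (use fin in auto)
  also have "\<dots> \<le> (\<Sum>T\<in>Pow ?I. card {j \<in> W. S j = T})"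
    by (rule card_UN_le) simp
  finally have le: "card W \<le> (\<Sum>T\<in>Pow ?I. card {j \<in> W. S j = T})" .
  \<comment> \<open>\<open>k\<close> blocks stacked over the same \<open>k\<close> columns contain every pattern\<close>
  have "\<exists>T\<in>Pow ?I. k \<le> card {j \<in> W. S j = T}"
  proof (rule ccontr)
    assume "\<not> ?thesis"
    then have "(\<Sum>T\<in>Pow ?I. card {j \<in> W. S j = T}) \<le> (\<Sum>T\<in>Pow ?I. k)"
      by (intro sum_mono) (meson nat_le_linear)
    also have "\<dots> = k * 2 ^ s" by (simp add: card_Pow)
    finally show False using le \<open>\<not> card W \<le> _\<close> by simp
  qed
  then obtain T where T: "T \<subseteq> ?I" "k \<le> card {j \<in> W. S j = T}" by blast
  obtain J where J: "strict_mono_on {1..k} J" "J ` {1..k} \<subseteq> {j \<in> W. S j = T}"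
    using obtain_strict_mono_on_into[OF _ T(2)] fin by auto
  have "mcontains k \<pi> M"
  proof (cases "k = 0")
    case True
    then show ?thesis by (auto simp: mcontains_def)
  next
    case False
    \<comment> \<open>That \<open>T\<close> has \<open>k\<close> elements is read off from a block
      that selected it; index 1 supplies one.\<close>
    then have "1 \<in> {1..k}" by simp
    then have "J 1 \<in> W" "S (J 1) = T" using J(2) by blast+
    then have "card T = k" using S(2) by blast
    then obtain x where x: "strict_mono_on {1..k} x" "x ` {1..k} \<subseteq> T"
      using obtain_strict_mono_on_into[of T k] finite_subset[OF T(1)] by auto
    \<comment> \<open>In the \<open>m\<close>-th common column the point is taken from block row
      \<open>J (\<pi> m)\<close>, so the heights are ordered like \<open>\<pi>\<close>.\<close>
    have "\<exists>b. (x m, b) \<in> M \<and> b div s = J (\<pi> m)" if m: "m \<in> {1..k}" for m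
    proof -
      have "\<pi> m \<in> {1..k}" using m by (simp only: permutes_in_image[OF \<pi>])
      then have "J (\<pi> m) \<in> W" "S (J (\<pi> m)) = T" using J(2) by blast+
      then have "x m \<in> block_cols s M (i, J (\<pi> m))" using S(1) x(2) m by blast
      then show ?thesis by (auto simp: block_cols_def block_def)
    qed
    then obtain b where b: "\<And>m. m \<in> {1..k} \<Longrightarrow> (x m, b m) \<in> M"
      "\<And>m. m \<in> {1..k} \<Longrightarrow> b m div s = J (\<pi> m)" by metis
    show ?thesis
    proof (rule mcontainsI[OF \<pi> x(1)])
      show "b m < b m'" if m: "m \<in> {1..k}" "m' \<in> {1..k}" "\<pi> m < \<pi> m'" for m m'
      proof (rule div_less_imp_less[of _ s])
        have "\<pi> m \<in> {1..k}" "\<pi> m' \<in> {1..k}" using m by (simp_all only: permutes_in_image[OF \<pi>])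
        then show "b m div s < b m' div s"
          using strict_mono_onD[OF J(1)] m b(2) by simp
      qed
    qed (rule b(1))
  qed
  with M show False ..
qed

section \<open>Points per block and the number of wide blocks\<close>

lemma block_fibre_subset:
  assumes "s > 0"
  shows "{q. block s q = (i, j)} \<subseteq> {i * s..<i * s + s} \<times> {j * s..<j * s + s}"
  using assms by (auto simp: block_def dividend_less_times_div mult.commute add.commute)

lemma card_block_fibre_le:
  assumes "s > 0"
  shows "finite {q. block s q = p}" "card {q. block s q = p} \<le> s\<^sup>2"
proof -
  obtain i j where p: "p = (i, j)" by force
  note sub = block_fibre_subset[OF assms, of i j]
  show "finite {q. block s q = p}" unfolding p by (rule finite_subset[OF sub]) simp
  show "card {q. block s q = p} \<le> s\<^sup>2"
    unfolding p using card_mono[OF _ sub] by (simp add: card_cartesian_product power2_eq_square)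
qed

lemma block_image_square:
  assumes "s > 0" "M \<subseteq> {..<s ^ Suc t} \<times> {..<s ^ Suc t}"
  shows "block s ` M \<subseteq> {..<s ^ t} \<times> {..<s ^ t}"
  using assms by (force simp: block_def div_less_iff_less_mult mult.commute)

text \<open>The points of a block lie in the product of its occupied columns and its occupied rows.
  The index pair is swapped for the rows because they are columns of
  \<open>M\<inverse>\<close>.\<close>

lemma card_narrow_short_block_le:
  assumes k: "k > 0" and s: "s > 0"
    and narrow: "card (block_cols s M (i, j)) < k"
    and short: "card (block_cols s (M\<inverse>) (j, i)) < k"
  shows "card {q \<in> M. block s q = (i, j)} \<le> (k - 1)\<^sup>2"
proof -
  have "{q \<in> M. block s q = (i, j)} \<subseteq> block_cols s M (i, j) \<times> block_cols s (M\<inverse>) (j, i)"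
    by (force simp: block_cols_def block_def)
  moreover have "finite (block_cols s M (i, j) \<times> block_cols s (M\<inverse>) (j, i))"
    using block_cols_subset[OF s] by (meson finite_SigmaI finite_atLeastLessThan finite_subset)
  ultimately have "card {q \<in> M. block s q = (i, j)}
      \<le> card (block_cols s M (i, j) \<times> block_cols s (M\<inverse>) (j, i))"
    by (simp add: card_mono)
  also have "\<dots> \<le> (k - 1) * (k - 1)"
    unfolding card_cartesian_product by (rule mult_le_mono) (use narrow short in auto)
  finally show ?thesis by (simp add: power2_eq_square)
qed

text \<open>The pigeonhole bound is added over the \<open>N\<close> block columns. Applied to
  \<open>M\<inverse>\<close>, the same estimate counts the tall blocks.\<close>

lemma card_wide_le:
  assumes \<pi>: "\<pi> permutes {1..k}" and M: "\<not> mcontains k \<pi> M" and s: "s > 0"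
    and B: "B \<subseteq> {..<N} \<times> {..<N}"
  shows "card {p \<in> B. k \<le> card (block_cols s M p)} \<le> N * (k * 2 ^ s)"
proof -
  let ?W = "\<lambda>i. {j \<in> {..<N}. k \<le> card (block_cols s M (i, j))}"
  have "{p \<in> B. k \<le> card (block_cols s M p)} \<subseteq> Sigma {..<N} ?W" using B by auto
  then have "card {p \<in> B. k \<le> card (block_cols s M p)} \<le> card (Sigma {..<N} ?W)"
    by (rule card_mono[rotated]) auto
  also have "\<dots> = (\<Sum>i<N. card (?W i))" by (rule card_SigmaI) auto
  also have "\<dots> \<le> (\<Sum>i<N. k * 2 ^ s)"
    by (intro sum_mono card_wide_blocks_le[OF \<pi> M s]) auto
  finally show ?thesis by simp
qed

text \<open>With \<open>s = k\<^sup>2\<close> this is \<open>2 * s\<^sup>2 * (k * 2 ^ s)\<close>: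
  wide and tall blocks give the factor 2, each holds at most \<open>s\<^sup>2\<close> points, and
  \<open>k * 2 ^ s\<close> bounds their number per block column or row.\<close>

definition mt_const :: "nat \<Rightarrow> nat" where
  "mt_const k = 2 * (k\<^sup>2)\<^sup>2 * (k * 2 ^ k\<^sup>2)"

text \<open>
  Contracting $k^2 \times k^2$ blocks preserves avoidance. Few blocks are wide or tall, the
  others hold at most $(k-1)^2$ points, and $(k-1)^2 < k^2$ makes the recursion linear.
\<close>

theorem marcus_tardos:
  assumes k: "k > 0" and \<pi>: "\<pi> permutes {1..k}"
    and "M \<subseteq> {..<(k\<^sup>2) ^ t} \<times> {..<(k\<^sup>2) ^ t}" and "\<not> mcontains k \<pi> M"
  shows "card M \<le> mt_const k * (k\<^sup>2) ^ t"
  using assms(3,4)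
proof (induction t arbitrary: M)
  case 0
  then have "card M \<le> card {(0::nat, 0::nat)}" by (intro card_mono) auto
  also have "\<dots> \<le> mt_const k * (k\<^sup>2) ^ 0"
    using k by (simp add: mt_const_def Suc_le_eq)
  finally show ?case .
next
  case (Suc t)
  define s where "s = k\<^sup>2"
  define D where "D = mt_const k"
  have s: "s > 0" using k by (simp add: s_def)
  let ?B = "block s ` M"
  let ?fib = "\<lambda>p. {q \<in> M. block s q = p}"
  let ?W = "{p \<in> ?B. k \<le> card (block_cols s M p)}"
  let ?T = "{p \<in> ?B. k \<le> card (block_cols s (M\<inverse>) (prod.swap p))}"
  have B: "?B \<subseteq> {..<s ^ t} \<times> {..<s ^ t}"
    using Suc.prems(1) s by (intro block_image_square) (auto simp: s_def)
  have finB: "finite ?B" by (rule finite_subset[OF B]) simp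
  have cB: "card ?B \<le> D * s ^ t"
    unfolding s_def D_def
    using Suc.IH[of ?B] B mcontains_of_blocks[OF \<pi>] Suc.prems(2) unfolding s_def by blast
  have cW: "card ?W \<le> s ^ t * (k * 2 ^ s)"
    by (rule card_wide_le[OF \<pi> Suc.prems(2) s B])
  have cT: "card ?T \<le> s ^ t * (k * 2 ^ s)"
  proof -
    have "card ?T = card (prod.swap ` ?T)" by (simp add: card_image inj_on_def)
    also have "prod.swap ` ?T = {p \<in> prod.swap ` ?B. k \<le> card (block_cols s (M\<inverse>) p)}" by auto
    also have "card \<dots> \<le> s ^ t * (k * 2 ^ s)"
    proof (rule card_wide_le[OF permutes_inv[OF \<pi>] _ s])
      show "\<not> mcontains k (inv \<pi>) (M\<inverse>)" using mcontains_converse[OF \<pi>] Suc.prems(2) by blast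
      show "prod.swap ` ?B \<subseteq> {..<s ^ t} \<times> {..<s ^ t}" using B by auto
    qed
    finally show ?thesis .
  qed
  \<comment> \<open>Each wide or tall block is charged all of its \<open>s\<^sup>2\<close> cells; a
    block that is both is charged twice, which only weakens the bound.\<close>
  have fib: "card (?fib p) \<le> (k - 1)\<^sup>2 + s\<^sup>2 * (of_bool (p \<in> ?W) + of_bool (p \<in> ?T))" if "p \<in> ?B" for p
  proof (cases "p \<in> ?W \<or> p \<in> ?T")
    case True
    have "card (?fib p) \<le> card {q. block s q = p}"
      by (rule card_mono) (use card_block_fibre_le[OF s] in auto)
    also have "\<dots> \<le> s\<^sup>2" by (rule card_block_fibre_le[OF s])
    also have "\<dots> \<le> s\<^sup>2 * (of_bool (p \<in> ?W) + of_bool (p \<in> ?T))" using True by auto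
    finally show ?thesis by linarith
  next
    case False
    obtain i j where p: "p = (i, j)" by force
    have "card (?fib (i, j)) \<le> (k - 1)\<^sup>2"
      by (rule card_narrow_short_block_le[OF k s]) (use False that p in auto)
    then show ?thesis using p by simp
  qed
  have "M = (\<Union>p\<in>?B. ?fib p)" by auto
  then have "card M \<le> (\<Sum>p\<in>?B. card (?fib p))" using card_UN_le[OF finB, of ?fib] by simp
  also have "\<dots> \<le> (\<Sum>p\<in>?B. (k - 1)\<^sup>2 + s\<^sup>2 * (of_bool (p \<in> ?W) + of_bool (p \<in> ?T)))"
    by (rule sum_mono[OF fib])
  also have "\<dots> = (k - 1)\<^sup>2 * card ?B + s\<^sup>2 * (card ?W + card ?T)"
    using finB by (simp add: sum.distrib flip: sum_distrib_left)
      (simp add: of_bool_def sum.If_cases Int_def conj_commute)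
  also have "\<dots> \<le> (k - 1)\<^sup>2 * (D * s ^ t) + s\<^sup>2 * (s ^ t * (k * 2 ^ s) + s ^ t * (k * 2 ^ s))"
    by (intro add_mono mult_left_mono cB cW cT) auto
  \<comment> \<open>By the choice of \<open>mt_const\<close>, the wide and tall blocks contribute
    exactly one more \<open>D * s ^ t\<close>.\<close>
  also have "\<dots> = ((k - 1)\<^sup>2 + 1) * (D * s ^ t)"
    by (simp add: D_def mt_const_def s_def algebra_simps)
  also have "\<dots> \<le> s * (D * s ^ t)"
  proof (rule mult_right_mono)
    show "(k - 1)\<^sup>2 + 1 \<le> s"
      using k by (cases k) (auto simp: s_def power2_eq_square)
  qed simp
  finally show ?case by (simp add: s_def D_def mult.left_commute)
qed

section \<open>Exponential growth of pattern-avoiding bijections\<close>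

text \<open>
  Klazar's counting argument, run with the block size $k^2$ instead of 2: the contraction of an
  avoiding set has linearly many points, and each nonempty block is filled in at most
  $2^{k^4}$ ways.
\<close>

lemma card_avoiding_sets_le:
  assumes k: "k \<ge> 2" and \<pi>: "\<pi> permutes {1..k}"
  shows "card {M. M \<subseteq> {..<(k\<^sup>2) ^ t} \<times> {..<(k\<^sup>2) ^ t} \<and> \<not> mcontains k \<pi> M}
    \<le> 2 ^ ((k\<^sup>2)\<^sup>2 * mt_const k * (k\<^sup>2) ^ t)"
proof (induction t)
  case 0
  let ?A = "{M. M \<subseteq> {..<(k\<^sup>2) ^ 0} \<times> {..<(k\<^sup>2) ^ 0} \<and> \<not> mcontains k \<pi> M}"
  have "card ?A \<le> card (Pow {(0::nat, 0::nat)})" by (rule card_mono) auto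
  also have "\<dots> = 2 ^ 1" by (simp add: card_Pow)
  also have "\<dots> \<le> 2 ^ ((k\<^sup>2)\<^sup>2 * mt_const k * (k\<^sup>2) ^ 0)"
    by (rule power_increasing) (use k in \<open>auto simp: Suc_le_eq mt_const_def\<close>)
  finally show ?case .
next
  case (Suc t)
  define s where "s = k\<^sup>2"
  define D where "D = mt_const k"
  define A where "A t = {M. M \<subseteq> {..<s ^ t} \<times> {..<s ^ t} \<and> \<not> mcontains k \<pi> M}" for t
  have s: "s \<ge> 2" using k power_increasing[of 1 2 k] by (simp add: s_def)
  have finA: "finite (A t)" for t
    by (rule finite_subset[of _ "Pow ({..<s ^ t} \<times> {..<s ^ t})"]) (auto simp: A_def)
  \<comment> \<open>All cells of the blocks in \<open>B\<close>; every set with contraction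
    \<open>B\<close> is a subset of them.\<close>
  let ?cells = "\<lambda>B. \<Union>p\<in>B. {q. block s q = p}"
  have fin_cells: "finite (?cells B)" and card_cells: "card (?cells B) \<le> s\<^sup>2 * (D * s ^ t)"
    if B: "B \<in> A t" for B
  proof -
    have finB: "finite B" using B by (auto simp: A_def intro: finite_subset)
    show "finite (?cells B)" using finB card_block_fibre_le s by auto
    have "card (?cells B) \<le> (\<Sum>p\<in>B. card {q. block s q = p})" by (rule card_UN_le[OF finB])
    also have "\<dots> \<le> (\<Sum>p\<in>B. s\<^sup>2)" by (intro sum_mono card_block_fibre_le) (use s in auto)
    also have "\<dots> = s\<^sup>2 * card B" by simp
    also have "\<dots> \<le> s\<^sup>2 * (D * s ^ t)"
      unfolding D_def s_def
      by (intro mult_left_mono marcus_tardos[OF _ \<pi>]) (use k B in \<open>auto simp: A_def s_def\<close>)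
    finally show "card (?cells B) \<le> s\<^sup>2 * (D * s ^ t)" .
  qed
  have "A (Suc t) \<subseteq> (\<Union>B\<in>A t. Pow (?cells B))"
  proof
    fix M assume M: "M \<in> A (Suc t)"
    then have "block s ` M \<in> A t"
      using block_image_square[of s M t] mcontains_of_blocks[OF \<pi>, of s M] s by (auto simp: A_def)
    moreover have "M \<in> Pow (?cells (block s ` M))" by auto
    ultimately show "M \<in> (\<Union>B\<in>A t. Pow (?cells B))" by blast
  qed
  then have "card (A (Suc t)) \<le> card (\<Union>B\<in>A t. Pow (?cells B))"
    by (rule card_mono[rotated]) (use finA fin_cells in auto)
  also have "\<dots> \<le> (\<Sum>B\<in>A t. card (Pow (?cells B)))" by (rule card_UN_le[OF finA])
  also have "\<dots> \<le> (\<Sum>B\<in>A t. 2 ^ (s\<^sup>2 * (D * s ^ t)))"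
  proof (rule sum_mono)
    fix B assume B: "B \<in> A t"
    show "card (Pow (?cells B)) \<le> 2 ^ (s\<^sup>2 * (D * s ^ t))"
      unfolding card_Pow[OF fin_cells[OF B]] by (rule power_increasing[OF card_cells[OF B]]) simp
  qed
  also have "\<dots> = card (A t) * 2 ^ (s\<^sup>2 * (D * s ^ t))" by simp
  also have "\<dots> \<le> 2 ^ (s\<^sup>2 * D * s ^ t) * 2 ^ (s\<^sup>2 * (D * s ^ t))"
    by (rule mult_right_mono) (use Suc.IH in \<open>auto simp: A_def D_def s_def\<close>)
  also have "\<dots> = 2 ^ (2 * (s\<^sup>2 * D * s ^ t))" by (simp add: mult.assoc mult_2 power_add)
  \<comment> \<open>The induction hypothesis and the fillings have equal exponents. Their sum is
    absorbed because the side grows by the factor \<open>s \<ge> 2\<close>.\<close>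
  also have "\<dots> \<le> 2 ^ (s * (s\<^sup>2 * D * s ^ t))" by (intro power_increasing mult_right_mono s) auto
  finally show ?case by (simp add: A_def D_def s_def mult_ac)
qed

section \<open>From point sets to bijections of finite sets\<close>

lemma strict_mono_on_rank:
  fixes A :: "nat set"
  assumes "finite A"
  shows "strict_mono_on A (\<lambda>a. card {x \<in> A. x < a})"
  by (intro strict_mono_onI psubset_card_mono) (use assms in auto)

lemma rank_less_card:
  fixes A :: "nat set"
  assumes "finite A" "a \<in> A"
  shows "card {x \<in> A. x < a} < card A"
  by (rule psubset_card_mono) (use assms in auto)

text \<open>With \<open>Pow A\<close> as edge set every \<open>k\<close>-subset of \<open>A\<close>
  is an edge, so \<open>havoids\<close> becomes ordinary pattern avoidance on \<open>A\<close>.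
  Extensionality makes a function determined by its values on \<open>A\<close>, so that the set can
  be counted.\<close>

definition avoiding_bijections :: "nat \<Rightarrow> (nat \<Rightarrow> nat) \<Rightarrow> nat set \<Rightarrow> nat set \<Rightarrow> (nat \<Rightarrow> nat) set" where
  "avoiding_bijections k \<pi> A B = {g \<in> extensional A. bij_betw g A B \<and> havoids (Pow A) g k \<pi>}"

lemma finite_avoiding_bijections:
  assumes "finite A" "finite B"
  shows "finite (avoiding_bijections k \<pi> A B)"
  by (rule finite_subset[OF _ finite_PiE[OF assms(1), of "\<lambda>_. B"]])
    (use assms in \<open>auto simp: avoiding_bijections_def PiE_def bij_betw_def\<close>)

text \<open>The last factor \<open>k\<^sup>2\<close> in the exponent pays for rounding a set size up
  to a power of \<open>k\<^sup>2\<close>.\<close>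

definition sw_const :: "nat \<Rightarrow> nat" where
  "sw_const k = 2 ^ ((k\<^sup>2)\<^sup>2 * mt_const k * k\<^sup>2)"

text \<open>Replacing elements of \<open>A\<close> and \<open>B\<close> by their ranks turns the
  graph of a bijection into a point set in a square. This is injective, and since ranks preserve
  order, a pattern in the point set lifts to one in the bijection. It remains to count avoiding
  point sets.\<close>

theorem stanley_wilf:
  assumes k: "k \<ge> 2" and \<pi>: "\<pi> permutes {1..k}" and fin: "finite A" "finite B"
  shows "card (avoiding_bijections k \<pi> A B) \<le> sw_const k ^ card A"
proof (cases "A \<noteq> {} \<and> card A = card B")
  case False
  show ?thesis
  \<comment> \<open>An empty \<open>A\<close> admits only one extensional function; otherwise the
    sizes differ and there is no bijection at all.\<close>
  proof (cases "A = {}")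
    case True
    then have "avoiding_bijections k \<pi> A B \<subseteq> {\<lambda>_. undefined}"
      by (auto simp: avoiding_bijections_def)
    then have "card (avoiding_bijections k \<pi> A B) \<le> card {\<lambda>_::nat. undefined::nat}"
      by (intro card_mono) auto
    then show ?thesis using True by simp
  next
    case nonempty: False
    then have "avoiding_bijections k \<pi> A B = {}"
      using False bij_betw_same_card by (auto simp: avoiding_bijections_def)
    then show ?thesis by simp
  qed
next
  case True
  define s where "s = k\<^sup>2"
  define q where "q = card A"
  have s: "s \<ge> 2" using k power_increasing[of 1 2 k] by (simp add: s_def)
  have q: "q \<ge> 1" using conjunct1[OF True] fin(1) by (simp add: q_def Suc_le_eq card_gt_0_iff)
  \<comment> \<open>The square's side must be a power of \<open>s\<close>; rounding \<open>q\<close>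
    up to one costs at most a factor \<open>s\<close>.\<close>
  obtain t where t: "q \<le> s ^ t" "s ^ t \<le> s * q"
  proof (cases "q = 1")
    case True
    with that[of 0] s show ?thesis by simp
  next
    case False
    then obtain t where "s ^ t < q" "q \<le> s ^ (t + 1)" using ex_power_ivl2[OF s, of q] q by auto
    with that[of "Suc t"] show ?thesis by simp
  qed
  define r where "r S a = card {x \<in> S. x < a}" for S :: "nat set" and a
  define G where "G g = (\<lambda>a. (r A a, r B (g a))) ` A" for g
  have mono: "strict_mono_on S (r S)" if "finite S" for S
    unfolding r_def by (rule strict_mono_on_rank[OF that])
  have r_less: "r S a < card S" if "finite S" "a \<in> S" for S a
    unfolding r_def by (rule rank_less_card[OF that])
  let ?M = "{M. M \<subseteq> {..<s ^ t} \<times> {..<s ^ t} \<and> \<not> mcontains k \<pi> M}"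
  have "inj_on G (avoiding_bijections k \<pi> A B)"
  proof (rule inj_onI)
    fix g h assume gh: "g \<in> avoiding_bijections k \<pi> A B" "h \<in> avoiding_bijections k \<pi> A B" "G g = G h"
    show "g = h"
    proof (rule extensionalityI[of _ A])
      fix a assume a: "a \<in> A"
      then have "(r A a, r B (g a)) \<in> G h" using gh(3) by (auto simp: G_def)
      then obtain a' where a': "a' \<in> A" "r A a = r A a'" "r B (g a) = r B (h a')" by (auto simp: G_def)
      then have "a = a'" using strict_mono_on_eqD[OF mono[OF fin(1)]] a by metis
      moreover have "g a \<in> B" "h a' \<in> B"
        using gh a a'(1) by (auto simp: avoiding_bijections_def bij_betw_def)
      ultimately show "g a = h a" using strict_mono_on_eqD[OF mono[OF fin(2)]] a'(3) by metis
    qed (use gh in \<open>auto simp: avoiding_bijections_def\<close>)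
  qed
  moreover have "G ` avoiding_bijections k \<pi> A B \<subseteq> ?M"
  proof (rule image_subsetI)
    fix g assume g: "g \<in> avoiding_bijections k \<pi> A B"
    then have gB: "g a \<in> B" if "a \<in> A" for a
      using that by (auto simp: avoiding_bijections_def bij_betw_def)
    have "G g \<subseteq> {..<q} \<times> {..<q}"
      using r_less[OF fin(1)] r_less[OF fin(2)] gB True by (auto simp: G_def q_def)
    also have "\<dots> \<subseteq> {..<s ^ t} \<times> {..<s ^ t}" using t(1) by auto
    finally have sub: "G g \<subseteq> {..<s ^ t} \<times> {..<s ^ t}" .
    have "\<not> mcontains k \<pi> (G g)"
    proof
      assume "mcontains k \<pi> (G g)"
      then obtain x y where xy: "strict_mono_on {1..k} x" "strict_mono_on {1..k} y"
        "\<forall>i\<in>{1..k}. (x i, y (\<pi> i)) \<in> G g" unfolding mcontains_def by blast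
      have "\<forall>i\<in>{1..k}. \<exists>a\<in>A. x i = r A a \<and> y (\<pi> i) = r B (g a)"
        using xy(3) unfolding G_def by blast
      then obtain a where a: "\<And>i. i \<in> {1..k} \<Longrightarrow> a i \<in> A" "\<And>i. i \<in> {1..k} \<Longrightarrow> x i = r A (a i)"
        "\<And>i. i \<in> {1..k} \<Longrightarrow> y (\<pi> i) = r B (g (a i))" by metis
      have "strict_mono_on {1..k} a"
      proof (rule strict_mono_onI)
        fix i j assume ij: "i \<in> {1..k}" "j \<in> {1..k}" "i < j"
        then have "r A (a i) < r A (a j)" using strict_mono_onD[OF xy(1) ij] a(2) by simp
        then show "a i < a j" using strict_mono_on_less[OF mono[OF fin(1)]] a(1) ij by blast
      qed
      moreover have "a ` {1..k} \<in> Pow A" using a(1) by blast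
      moreover have "\<pi> i < \<pi> j \<longleftrightarrow> g (a i) < g (a j)" if ij: "i \<in> {1..k}" "j \<in> {1..k}" for i j
      proof -
        have "\<pi> i \<in> {1..k}" "\<pi> j \<in> {1..k}" using ij by (simp_all only: permutes_in_image[OF \<pi>])
        then have "\<pi> i < \<pi> j \<longleftrightarrow> y (\<pi> i) < y (\<pi> j)" using strict_mono_on_less[OF xy(2)] by blast
        also have "\<dots> \<longleftrightarrow> g (a i) < g (a j)"
          using strict_mono_on_less[OF mono[OF fin(2)], of "g (a i)" "g (a j)"] a gB ij by simp
        finally show ?thesis .
      qed
      ultimately have "hcontains (Pow A) g k \<pi>" unfolding hcontains_def by blast
      with g show False by (simp add: avoiding_bijections_def havoids_def)
    qed
    with sub show "G g \<in> ?M" by blast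
  qed
  moreover have "finite ?M"
    by (rule finite_subset[of _ "Pow ({..<s ^ t} \<times> {..<s ^ t})"]) auto
  ultimately have "card (avoiding_bijections k \<pi> A B) \<le> card ?M" by (rule card_inj_on_le)
  also have "\<dots> \<le> 2 ^ ((k\<^sup>2)\<^sup>2 * mt_const k * s ^ t)"
    using card_avoiding_sets_le[OF k \<pi>, of t] by (simp only: s_def)
  also have "\<dots> \<le> 2 ^ ((k\<^sup>2)\<^sup>2 * mt_const k * (s * q))"
    by (intro power_increasing mult_left_mono t(2)) auto
  also have "\<dots> = sw_const k ^ card A"
    by (simp add: sw_const_def s_def q_def mult.assoc flip: power_mult)
  finally show ?thesis .
qed

section \<open>Counting permutations avoiding a pattern on a cover by cliques\<close>

text \<open>The chosen cliques \<open>c v\<close> split \<open>V\<close> into classes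
  \<open>X Q\<close>. Recording for each value the class of its preimage costs
  \<open>card C ^ card V\<close> and fixes the image \<open>Y f Q\<close> of each class. The
  restrictions are then avoiding bijections between known sets.\<close>

lemma card_cover_avoiders_le:
  assumes k: "k \<ge> 2" and \<pi>: "\<pi> permutes {1..k}" and C: "finite C"
    and cover: "\<And>v. v \<in> V \<Longrightarrow> \<exists>Q\<in>C. v \<in> Q" and V: "finite V"
    and cl: "\<And>Q S. Q \<in> C \<Longrightarrow> S \<subseteq> Q \<Longrightarrow> card S = k \<Longrightarrow> S \<in> E"
  shows "card {\<sigma>. \<sigma> permutes V \<and> havoids E \<sigma> k \<pi>} \<le> (card C * sw_const k) ^ card V"
proof -
  obtain c where c: "\<And>v. v \<in> V \<Longrightarrow> c v \<in> C" "\<And>v. v \<in> V \<Longrightarrow> v \<in> c v"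
    using cover by metis
  let ?S = "{\<sigma>. \<sigma> permutes V \<and> havoids E \<sigma> k \<pi>}"
  define X where "X Q = {v \<in> V. c v = Q}" for Q
  define Y where "Y f Q = {v \<in> V. f v = Q}" for f :: "nat \<Rightarrow> nat set" and Q
  let ?F = "V \<rightarrow>\<^sub>E C"
  let ?P = "\<lambda>f. \<Pi>\<^sub>E Q\<in>C. avoiding_bijections k \<pi> (X Q) (Y f Q)"
  \<comment> \<open>The first component is indexed by values, the second by cliques. The first
    determines the targets of the second, hence the dependent sum
    \<open>Sigma ?F ?P\<close>.\<close>
  define H where "H \<sigma> = (restrict (c \<circ> inv \<sigma>) V, \<lambda>Q\<in>C. restrict \<sigma> (X Q))" for \<sigma>
  have finP: "finite (?P f)" for f
    by (intro finite_PiE C finite_avoiding_bijections) (use V in \<open>auto simp: X_def Y_def\<close>)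
  have finF: "finite ?F" using V C by (simp add: finite_PiE)
  have "inj_on H ?S"
  proof (rule inj_onI)
    fix \<sigma> \<tau> assume st: "\<sigma> \<in> ?S" "\<tau> \<in> ?S" "H \<sigma> = H \<tau>"
    show "\<sigma> = \<tau>"
    proof
      fix v show "\<sigma> v = \<tau> v"
      proof (cases "v \<in> V")
        case True
        have "restrict \<sigma> (X (c v)) = restrict \<tau> (X (c v))"
          using st(3) c(1)[OF True] by (auto simp: H_def dest: fun_cong[of _ _ "c v"])
        then have "restrict \<sigma> (X (c v)) v = restrict \<tau> (X (c v)) v" by simp
        then show ?thesis using True by (simp add: X_def)
      next
        case False
        then show ?thesis using st(1,2) by (auto simp: permutes_def)
      qed
    qed
  qed
  moreover have "H ` ?S \<subseteq> Sigma ?F ?P"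
  proof (rule image_subsetI)
    fix \<sigma> assume \<sigma>: "\<sigma> \<in> ?S"
    then have perm: "\<sigma> permutes V" by simp
    let ?f = "restrict (c \<circ> inv \<sigma>) V"
    have f: "?f \<in> ?F" using c(1) permutes_in_image[OF permutes_inv[OF perm]] by auto
    have "restrict \<sigma> (X Q) \<in> avoiding_bijections k \<pi> (X Q) (Y ?f Q)" if Q: "Q \<in> C" for Q
    proof -
      have "\<sigma> ` X Q = Y ?f Q"
      proof
        show "\<sigma> ` X Q \<subseteq> Y ?f Q"
          by (auto simp: X_def Y_def permutes_in_image[OF perm] permutes_inverses[OF perm])
        show "Y ?f Q \<subseteq> \<sigma> ` X Q"
        proof
          fix w assume "w \<in> Y ?f Q"
          then have "inv \<sigma> w \<in> X Q"
            by (auto simp: X_def Y_def permutes_in_image[OF permutes_inv[OF perm]])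
          then show "w \<in> \<sigma> ` X Q" using permutes_inverses(1)[OF perm, of w] by (metis imageI)
        qed
      qed
      then have "bij_betw (restrict \<sigma> (X Q)) (X Q) (Y ?f Q)"
        using permutes_inj_on[OF perm] by (simp add: bij_betw_def)
      moreover have "havoids (Pow (X Q)) (restrict \<sigma> (X Q)) k \<pi>"
        unfolding havoids_def
      proof
        assume "hcontains (Pow (X Q)) (restrict \<sigma> (X Q)) k \<pi>"
        then obtain x where x: "strict_mono_on {1..k} x" "x ` {1..k} \<subseteq> X Q"
          "\<forall>i\<in>{1..k}. \<forall>j\<in>{1..k}. \<pi> i < \<pi> j \<longleftrightarrow> restrict \<sigma> (X Q) (x i) < restrict \<sigma> (X Q) (x j)"
          unfolding hcontains_def by blast
        have "card (x ` {1..k}) = k"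
          using strict_mono_on_imp_inj_on[OF x(1)] by (simp add: card_image)
        \<comment> \<open>Members of \<open>X Q\<close> lie in the clique \<open>Q\<close>, so any
          \<open>k\<close> of them form an edge.\<close>
        moreover have "x ` {1..k} \<subseteq> Q" using x(2) c(2) by (auto simp: X_def)
        ultimately have "x ` {1..k} \<in> E" using cl[OF Q] by blast
        moreover have "\<forall>i\<in>{1..k}. \<forall>j\<in>{1..k}. \<pi> i < \<pi> j \<longleftrightarrow> \<sigma> (x i) < \<sigma> (x j)"
          using x(2,3) by (simp add: image_subset_iff)
        ultimately have "hcontains E \<sigma> k \<pi>" using x(1) unfolding hcontains_def by blast
        with \<sigma> show False by (simp add: havoids_def)
      qed
      ultimately show ?thesis by (simp add: avoiding_bijections_def)
    qed
    then have "(\<lambda>Q\<in>C. restrict \<sigma> (X Q)) \<in> ?P ?f" by (intro restrict_PiE_iff[THEN iffD2]) blast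
    with f show "H \<sigma> \<in> Sigma ?F ?P" by (simp add: H_def)
  qed
  moreover have "finite (Sigma ?F ?P)" using finF finP by auto
  ultimately have "card ?S \<le> card (Sigma ?F ?P)" by (rule card_inj_on_le)
  also have "\<dots> = (\<Sum>f\<in>?F. card (?P f))" by (rule card_SigmaI) (use finF finP in auto)
  also have "\<dots> \<le> (\<Sum>f\<in>?F. sw_const k ^ card V)"
  proof (rule sum_mono)
    \<comment> \<open>The bound holds for any \<open>f\<close>, whether or not it comes from a
      permutation. The exponents add up to \<open>card V\<close> because the classes partition
      \<open>V\<close>.\<close>
    fix f
    have "card (?P f) = (\<Prod>Q\<in>C. card (avoiding_bijections k \<pi> (X Q) (Y f Q)))"
      by (rule card_PiE[OF C])
    also have "\<dots> \<le> (\<Prod>Q\<in>C. sw_const k ^ card (X Q))"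
      by (intro prod_mono conjI stanley_wilf[OF k \<pi>]) (use V in \<open>auto simp: X_def Y_def\<close>)
    also have "\<dots> = sw_const k ^ (\<Sum>Q\<in>C. card (X Q))" by (rule power_sum[symmetric])
    also have "(\<Sum>Q\<in>C. card (X Q)) = card (\<Union>Q\<in>C. X Q)"
      by (rule card_UN_disjoint[symmetric]) (use V C in \<open>auto simp: X_def\<close>)
    also have "(\<Union>Q\<in>C. X Q) = V" using c(1) by (auto simp: X_def)
    finally show "card (?P f) \<le> sw_const k ^ card V" .
  qed
  also have "\<dots> = (card C * sw_const k) ^ card V"
    using V by (simp add: card_funcsetE power_mult_distrib)
  finally show ?thesis .
qed

text \<open>Double counting of the incidences between vertices and cliques.\<close>

lemma card_clique_cover_le:
  fixes \<Delta> :: real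
  assumes fin: "finite C" "finite V" and C: "\<And>Q. Q \<in> C \<Longrightarrow> Q \<subseteq> V \<and> card Q = L"
    and deg: "\<And>v. v \<in> V \<Longrightarrow> real (card {Q \<in> C. v \<in> Q}) \<le> \<Delta>"
  shows "real L * real (card C) \<le> \<Delta> * real (card V)"
proof -
  have "(\<Sum>v\<in>V. card {Q \<in> C. v \<in> Q}) = (\<Sum>Q\<in>C. card {v \<in> V. v \<in> Q})"
    by (rule sum_multicount_gen) (use fin in auto)
  also have "\<dots> = (\<Sum>Q\<in>C. L)"
    by (rule sum.cong) (use C in \<open>auto intro!: arg_cong[of _ _ card] simp: Int_absorb1 simp flip: Int_def\<close>)
  finally have "real L * real (card C) = (\<Sum>v\<in>V. real (card {Q \<in> C. v \<in> Q}))"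
    by (simp add: mult.commute flip: of_nat_sum of_nat_mult)
  also have "\<dots> \<le> (\<Sum>v\<in>V. \<Delta>)" by (rule sum_mono) (rule deg)
  finally show ?thesis by (simp add: mult.commute)
qed

text \<open>The case \<open>n = 1\<close> is left out because there \<open>ln (real n)\<close> is 0
  and so is the bound, while the identity avoids every pattern of length at least 2.\<close>

theorem theorem2p4:
  fixes k :: nat and \<pi> :: "nat \<Rightarrow> nat" and \<epsilon> \<delta>\<^sub>0 \<Delta>\<^sub>0 :: real
  assumes "k \<ge> 2" and "\<pi> permutes {1..k}" and "\<epsilon> > 0"
    and "\<delta>\<^sub>0 \<ge> 1" and "\<Delta>\<^sub>0 > 0"
  shows "\<exists>c::real. \<forall>(n::nat) (L::nat) (E::nat set set) (C::nat set set).
           n \<ge> 2 \<longrightarrow> L > 0 \<longrightarrow> k_uniform_hypergraph k n E \<longrightarrow>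
           (\<forall>Q\<in>C. is_clique k n E L Q) \<longrightarrow>
           (\<forall>v\<in>{1..n}. \<delta>\<^sub>0 \<le> real (card {Q\<in>C. v \<in> Q}) \<and> real (card {Q\<in>C. v \<in> Q}) \<le> \<Delta>\<^sub>0) \<longrightarrow>
           real (card {\<sigma>. \<sigma> permutes {1..n} \<and> havoids E \<sigma> k \<pi>})
             \<le> (c * real n * (ln (real n)) powr (2 + \<epsilon>) / real L) ^ n"
proof -
  \<comment> \<open>The logarithmic factor at \<open>n = 2\<close>, its least value for
    \<open>n \<ge> 2\<close>. Dividing by it in the constant makes the normalised factor at least 1,
    so a bound without logarithms suffices.\<close>
  define l where "l = ln 2 powr (2 + \<epsilon>)"
  define K where "K = real (sw_const k)"
  have l: "l > 0" by (simp add: l_def)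
  have K: "K \<ge> 0" by (simp add: K_def)
  show ?thesis
  proof (intro exI[of _ "\<Delta>\<^sub>0 * K / l"] allI impI)
    fix n L :: nat and E C :: "nat set set"
    assume n: "n \<ge> 2" and L: "L > 0" and cl: "\<forall>Q\<in>C. is_clique k n E L Q"
      and deg: "\<forall>v\<in>{1..n}. \<delta>\<^sub>0 \<le> real (card {Q\<in>C. v \<in> Q}) \<and> real (card {Q\<in>C. v \<in> Q}) \<le> \<Delta>\<^sub>0"
    have finC: "finite C"
      by (rule finite_subset[of _ "Pow {1..n}"]) (use cl in \<open>auto simp: is_clique_def\<close>)
    have cover: "\<exists>Q\<in>C. v \<in> Q" if "v \<in> {1..n}" for v
    proof -
      \<comment> \<open>The lower bound \<open>\<delta>\<^sub>0 \<ge> 1\<close> on the degrees is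
        what makes the cliques a cover.\<close>
      have "real (card {Q\<in>C. v \<in> Q}) > 0" using deg that assms(4) by fastforce
      then show ?thesis by (auto simp: card_gt_0_iff)
    qed
    have "card {\<sigma>. \<sigma> permutes {1..n} \<and> havoids E \<sigma> k \<pi>} \<le> (card C * sw_const k) ^ card {1..n}"
      by (rule card_cover_avoiders_le[OF assms(1,2) finC cover])
        (use cl in \<open>auto simp: is_clique_def\<close>)
    then have "real (card {\<sigma>. \<sigma> permutes {1..n} \<and> havoids E \<sigma> k \<pi>}) \<le> real ((card C * sw_const k) ^ n)"
      by (simp only: card_atLeastAtMost of_nat_le_iff) simp
    also have "\<dots> = (real (card C) * K) ^ n" by (simp only: K_def of_nat_mult of_nat_power)
    also have "\<dots> \<le> (\<Delta>\<^sub>0 * K / l * real n * (ln (real n)) powr (2 + \<epsilon>) / real L) ^ n"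
    proof (rule power_mono)
      have "real L * real (card C) \<le> \<Delta>\<^sub>0 * real (card {1..n})"
        by (rule card_clique_cover_le[OF finC]) (use cl deg in \<open>auto simp: is_clique_def\<close>)
      then have "real (card C) \<le> \<Delta>\<^sub>0 * real n / real L" using L by (simp add: field_simps)
      then have "real (card C) * K \<le> \<Delta>\<^sub>0 * real n / real L * K" by (rule mult_right_mono[OF _ K])
      also have "\<dots> \<le> \<Delta>\<^sub>0 * real n / real L * K * (ln (real n) powr (2 + \<epsilon>) / l)"
      proof -
        have "l \<le> ln (real n) powr (2 + \<epsilon>)"
          unfolding l_def by (rule powr_mono2) (use n assms(3) in auto)
        then have "1 \<le> ln (real n) powr (2 + \<epsilon>) / l" using l by simp
        moreover have "0 \<le> \<Delta>\<^sub>0 * real n / real L * K" using K assms(5) by simp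
        ultimately show ?thesis using mult_left_mono by fastforce
      qed
      finally show "real (card C) * K \<le> \<Delta>\<^sub>0 * K / l * real n * (ln (real n)) powr (2 + \<epsilon>) / real L"
        by (simp add: mult_ac)
      show "0 \<le> real (card C) * K" using K by simp
    qed
    finally show "real (card {\<sigma>. \<sigma> permutes {1..n} \<and> havoids E \<sigma> k \<pi>})
      \<le> (\<Delta>\<^sub>0 * K / l * real n * (ln (real n)) powr (2 + \<epsilon>) / real L) ^ n" .
  qed
qed

end
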